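(* Let $\pi:(X,T)\to(Y,T)$ be an extension of minimal flows. Then the following are equivalent: (1) $\pi$ is almost proximal and point distal; (2) $\pi$ is almost finite to one.
   Context: $T$ is an infinite countable discrete group. A flow $(X,T)$ is a compact metric space $(X,d)$ with a continuous action of $T$; it is minimal if every orbit is dense. A point of a flow is minimal if its orbit closure is a minimal flow. An extension $\pi:(X,T)\to(Y,T)$ is a continuous surjective $T$-equivariant map. Powers $X^n$ carry the diagonal action. A subset $A\subseteq X$ is an almost periodic set if for every finite subset $\{x_1,\dots,x_n\}$ of $A$ the point $(x_1,\dots,x_n)$ is a minimal point of $(X^n,T)$. An extension $\pi$ of minimal flows is almost proximal if for each $y\in Y$ there is $N\in\mathbb{N}$ such that every almost periodic subset of $\pi^{-1}(y)$ has cardinality at most $N$. $\pi$ is almost finite to one if some fiber $\pi^{-1}(y)$ is finite. A pair $(x,x')$ is proximal if $\inf_{t\in T}d(tx,tx')=0$. A point $x\in X$ is $\pi$-distal if no $x'\in\pi^{-1}(\pi(x))\setminus\{x\}$ forms a proximal pair with $x$. $\pi$ is point distal if there exists a $\pi$-distal point in $X$. *)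

theory Defs
  imports "HOL-Analysis.Analysis" "HOL-Algebra.Group_Action"
begin

text \<open>
  A phase space is a compact subset of a metric space type. The library predicate
  \<^const>\<open>group_action\<close> requires every \<open>\<phi> g\<close> to be extensional on the phase space, hence the
  uses of \<^const>\<open>restrict\<close> below.
\<close>

definition flow ::
    "('g, 'm) monoid_scheme \<Rightarrow> 'a::metric_space set \<Rightarrow> ('g \<Rightarrow> 'a \<Rightarrow> 'a) \<Rightarrow> bool" where
  "flow T X \<phi> \<longleftrightarrow>
     compact X \<and> group_action T X \<phi> \<and>
     continuous_map (prod_topology (discrete_topology (carrier T)) (top_of_set X))
       (top_of_set X) (\<lambda>(g, x). \<phi> g x)"

definition minimal_flow ::
    "('g, 'm) monoid_scheme \<Rightarrow> 'a::metric_space set \<Rightarrow> ('g \<Rightarrow> 'a \<Rightarrow> 'a) \<Rightarrow> bool" where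
  "minimal_flow T X \<phi> \<longleftrightarrow> flow T X \<phi> \<and> (\<forall>x\<in>X. X \<subseteq> closure (orbit T \<phi> x))"

text \<open>
  The closure is taken in the ambient type; since \<open>X\<close> is compact, hence closed, this is the same
  as the closure in \<open>X\<close>.
\<close>

definition orbit_closure ::
    "('g, 'm) monoid_scheme \<Rightarrow> ('g \<Rightarrow> 'a::metric_space \<Rightarrow> 'a) \<Rightarrow> 'a \<Rightarrow> 'a set" where
  "orbit_closure T \<phi> x = closure (orbit T \<phi> x)"

definition minimal_point ::
    "('g, 'm) monoid_scheme \<Rightarrow> 'a::metric_space set \<Rightarrow> ('g \<Rightarrow> 'a \<Rightarrow> 'a) \<Rightarrow> 'a \<Rightarrow> bool" where
  "minimal_point T X \<phi> x \<longleftrightarrow>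
     x \<in> X \<and>
     minimal_flow T (orbit_closure T \<phi> x) (\<lambda>g. restrict (\<phi> g) (orbit_closure T \<phi> x))"

text \<open>
  Points of \<open>X\<^sup>n\<close> are the functions from \<open>{..<n}\<close> to \<open>X\<close> that are \<^const>\<open>undefined\<close> from \<open>n\<close> on.
  The metric that the type \<open>nat \<Rightarrow> 'a\<close> carries induces the product topology, and on \<open>X\<^sup>n\<close> this is
  the usual topology of the finite power.
\<close>

definition power_space :: "'a set \<Rightarrow> nat \<Rightarrow> (nat \<Rightarrow> 'a) set" where
  "power_space X n = {..<n} \<rightarrow>\<^sub>E X"

definition diagonal_action ::
    "'a set \<Rightarrow> ('g \<Rightarrow> 'a \<Rightarrow> 'a) \<Rightarrow> nat \<Rightarrow> 'g \<Rightarrow> (nat \<Rightarrow> 'a) \<Rightarrow> (nat \<Rightarrow> 'a)" where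
  "diagonal_action X \<phi> n g = (\<lambda>x\<in>power_space X n. \<lambda>i\<in>{..<n}. \<phi> g (x i))"

text \<open>
  A finite subset of \<open>A\<close> with \<open>n\<close> elements is presented by an injective enumeration \<open>x\<close>; all
  enumerations are considered.
\<close>

definition almost_periodic_set ::
    "('g, 'm) monoid_scheme \<Rightarrow> 'a::metric_space set \<Rightarrow> ('g \<Rightarrow> 'a \<Rightarrow> 'a) \<Rightarrow> 'a set \<Rightarrow> bool" where
  "almost_periodic_set T X \<phi> A \<longleftrightarrow>
     A \<subseteq> X \<and>
     (\<forall>n. \<forall>x \<in> {..<n} \<rightarrow>\<^sub>E A. inj_on x {..<n} \<longrightarrow>
        minimal_point T (power_space X n) (diagonal_action X \<phi> n) x)"

definition flow_extension ::
    "('g, 'm) monoid_scheme \<Rightarrow> 'a::metric_space set \<Rightarrow> ('g \<Rightarrow> 'a \<Rightarrow> 'a) \<Rightarrow>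
     'b::metric_space set \<Rightarrow> ('g \<Rightarrow> 'b \<Rightarrow> 'b) \<Rightarrow> ('a \<Rightarrow> 'b) \<Rightarrow> bool" where
  "flow_extension T X \<phi> Y \<psi> \<pi> \<longleftrightarrow>
     flow T X \<phi> \<and> flow T Y \<psi> \<and> continuous_on X \<pi> \<and> \<pi> ` X = Y \<and>
     (\<forall>g\<in>carrier T. \<forall>x\<in>X. \<pi> (\<phi> g x) = \<psi> g (\<pi> x))"

definition fiber :: "'a set \<Rightarrow> ('a \<Rightarrow> 'b) \<Rightarrow> 'b \<Rightarrow> 'a set" where
  "fiber X \<pi> y = {x \<in> X. \<pi> x = y}"

definition almost_proximal ::
    "('g, 'm) monoid_scheme \<Rightarrow> 'a::metric_space set \<Rightarrow> ('g \<Rightarrow> 'a \<Rightarrow> 'a) \<Rightarrow>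
     'b set \<Rightarrow> ('a \<Rightarrow> 'b) \<Rightarrow> bool" where
  "almost_proximal T X \<phi> Y \<pi> \<longleftrightarrow>
     (\<forall>y\<in>Y. \<exists>N::nat. \<forall>A. A \<subseteq> fiber X \<pi> y \<and> almost_periodic_set T X \<phi> A \<longrightarrow>
        finite A \<and> card A \<le> N)"

definition almost_finite_to_one :: "'a set \<Rightarrow> 'b set \<Rightarrow> ('a \<Rightarrow> 'b) \<Rightarrow> bool" where
  "almost_finite_to_one X Y \<pi> \<longleftrightarrow> (\<exists>y\<in>Y. finite (fiber X \<pi> y))"

definition proximal ::
    "('g, 'm) monoid_scheme \<Rightarrow> ('g \<Rightarrow> 'a::metric_space \<Rightarrow> 'a) \<Rightarrow> 'a \<Rightarrow> 'a \<Rightarrow> bool" where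
  "proximal T \<phi> x x' \<longleftrightarrow> (INF g\<in>carrier T. dist (\<phi> g x) (\<phi> g x')) = 0"

definition distal_point ::
    "('g, 'm) monoid_scheme \<Rightarrow> 'a::metric_space set \<Rightarrow> ('g \<Rightarrow> 'a \<Rightarrow> 'a) \<Rightarrow> ('a \<Rightarrow> 'b) \<Rightarrow> 'a \<Rightarrow> bool"
  where
  "distal_point T X \<phi> \<pi> x \<longleftrightarrow>
     x \<in> X \<and> \<not> (\<exists>x' \<in> fiber X \<pi> (\<pi> x) - {x}. proximal T \<phi> x x')"

definition point_distal ::
    "('g, 'm) monoid_scheme \<Rightarrow> 'a::metric_space set \<Rightarrow> ('g \<Rightarrow> 'a \<Rightarrow> 'a) \<Rightarrow> ('a \<Rightarrow> 'b) \<Rightarrow> bool" where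
  "point_distal T X \<phi> \<pi> \<longleftrightarrow> (\<exists>x\<in>X. distal_point T X \<phi> \<pi> x)"

end

theory Submission
  imports Defs
begin

text \<open>
  Let \<open>E\<close> be the Ellis semigroup of \<open>X\<close>. A finite set \<open>A\<close> is almost periodic iff every \<open>p \<in> E\<close> can
  be undone on \<open>A\<close> by some \<open>q \<in> E\<close>, so such sets can be moved injectively from any fiber into any
  other. By Baire category, for a continuous surjection \<open>f\<close> from a compact metric space onto \<open>Y\<close>
  there is \<open>y\<close> such that \<open>f\<close> is open at every point over \<open>y\<close>.

  If some fiber has \<open>N\<close> points, almost periodic subsets of fibers have at most \<open>N\<close> points. Choose \<open>y\<close>
  as above for \<open>\<pi>\<close>. Orbits are dense, so the fiber of \<open>y\<close> has some \<open>m \<le> N\<close> points; if two of them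
  were proximal, some translate of this fiber, over a point close to \<open>y\<close>, would have two points close
  to the same point of the fiber, yet it must meet the \<open>m\<close> disjoint balls around the fiber points.

  Conversely, let \<open>n\<close> be the maximal size of an almost periodic subset of a fiber. A minimal idempotent
  fixing such a maximal set \<open>A\<close> also fixes every \<open>\<pi>\<close>-distal point of the same fiber, so by maximality
  these points lie in \<open>A\<close>. The translates of an enumeration of \<open>A\<close> by \<open>E\<close> form a compact set \<open>M\<close> over
  \<open>Y\<close>. Let \<open>M \<rightarrow> Y\<close> be open at the points over \<open>y\<close>, and let \<open>z \<in> M\<close> lie over \<open>y\<close>. Distal points are
  dense, and each lies in all sets of \<open>M\<close> over its image; passing to the limit, every point of the
  fiber of \<open>y\<close> is one of the \<open>n\<close> entries of \<open>z\<close>.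
\<close>

section \<open>Spaces of functions and idempotents\<close>

lemma Hausdorff_space_euclidean_fun:
  "Hausdorff_space (euclidean :: ('i \<Rightarrow> 'b::metric_space) topology)"
  by (metis Hausdorff_space_euclidean Hausdorff_space_product_topology euclidean_product_topology)

text \<open>The index type may be uncountable, so the function space need not be metrizable;
  closedness comes from the product topology being Hausdorff.\<close>

lemma compact_imp_closed_fun:
  fixes S :: "('i \<Rightarrow> 'b::metric_space) set"
  assumes "compact S"
  shows "closed S"
  using compactin_imp_closedin[OF Hausdorff_space_euclidean_fun, of S] assms by simp

lemma compact_Pi_UNIV:
  fixes S :: "'i \<Rightarrow> 'b::metric_space set"
  assumes "\<And>i. compact (S i)"
  shows "compact (Pi UNIV S)"
proof -
  have "compactin (product_topology (\<lambda>i. euclidean) UNIV) (PiE UNIV S)"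
    using assms by (simp add: compactin_PiE)
  then show ?thesis
    by (simp add: euclidean_product_topology PiE_UNIV_domain)
qed

text \<open>Each coordinate of \<open>p \<circ> q\<close> is a coordinate of \<open>p\<close>, so
  \<open>q\<close> may be any map. Left composition with a discontinuous map need not be continuous,
  which is why later arguments multiply on the right.\<close>

lemma continuous_on_comp_right_fun:
  "continuous_on S (\<lambda>p :: 'j \<Rightarrow> 'b::topological_space. p \<circ> q)"
  unfolding comp_def
  by (intro continuous_on_coordinatewise_then_product)
     (rule continuous_on_subset[OF continuous_on_product_coordinates], simp)

text \<open>Zorn's lemma, with compactness making intersections of chains nonempty. It supplies
  minimal compact subsemigroups and minimal left ideals.\<close>

lemma compact_minimal_subset:
  assumes "S \<in> \<F>" and "\<And>K. K \<in> \<F> \<Longrightarrow> compact K \<and> closed K \<and> K \<noteq> {}"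
    and Inter: "\<And>\<C>. \<lbrakk>\<C> \<noteq> {}; \<C> \<subseteq> \<F>; \<Inter>\<C> \<noteq> {}\<rbrakk> \<Longrightarrow> \<Inter>\<C> \<in> \<F>"
  obtains M where "M \<in> \<F>" "\<And>K. \<lbrakk>K \<in> \<F>; K \<subseteq> M\<rbrakk> \<Longrightarrow> K = M"
proof -
  \<comment> \<open>Complements reverse inclusion, so the form of Zorn's lemma for maximal sets and
    unions of chains applies.\<close>
  have "\<exists>M\<in>uminus ` \<F>. \<forall>K\<in>uminus ` \<F>. M \<subseteq> K \<longrightarrow> K = M"
  proof (rule subset_Zorn_nonempty)
    show "uminus ` \<F> \<noteq> {}" using assms(1) by blast
    fix \<C> assume \<C>: "\<C> \<noteq> {}" "subset.chain (uminus ` \<F>) \<C>"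
    define \<D> where "\<D> = uminus ` \<C>"
    have D: "\<D> \<subseteq> \<F>" "\<D> \<noteq> {}"
      using \<C> by (auto simp: \<D>_def subset_chain_def)
    have chain: "K \<subseteq> L \<or> L \<subseteq> K" if "K \<in> \<D>" "L \<in> \<D>" for K L
    proof -
      have "- K \<in> \<C>" "- L \<in> \<C>" using that by (auto simp: \<D>_def)
      then have "- K \<subseteq> - L \<or> - L \<subseteq> - K" using \<C>(2) unfolding subset_chain_def by blast
      then show ?thesis by auto
    qed
    obtain K0 where K0: "K0 \<in> \<D>" using D by blast
    \<comment> \<open>In a chain, finitely many members have one of the chain below them all; this
      gives the finite intersection property.\<close>
    have fin: "\<exists>K\<in>\<D>. K \<subseteq> K0 \<inter> \<Inter>\<G>" if "finite \<G>" "\<G> \<subseteq> \<D>" for \<G>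
      using that
    proof (induction \<G>)
      case empty
      then show ?case using K0 by auto
    next
      case (insert L \<G>)
      then obtain K where K: "K \<in> \<D>" "K \<subseteq> K0 \<inter> \<Inter>\<G>" by blast
      have L: "L \<in> \<D>" using insert.prems by blast
      show ?case
      proof (cases "K \<subseteq> L")
        case True
        then show ?thesis using K by (intro bexI[of _ K]) auto
      next
        case False
        then have "L \<subseteq> K" using chain[OF K(1) L] by blast
        then show ?thesis using K L by (intro bexI[of _ L]) auto
      qed
    qed
    have "K0 \<inter> \<Inter>\<D> \<noteq> {}"
    proof (rule compact_imp_fip)
      show "compact K0" using K0 D assms(2)[of K0] by auto
      show "closed L" if "L \<in> \<D>" for L using that D assms(2)[of L] by auto
      show "K0 \<inter> \<Inter>\<G> \<noteq> {}" if "finite \<G>" "\<G> \<subseteq> \<D>" for \<G>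
      proof -
        obtain K where K: "K \<in> \<D>" "K \<subseteq> K0 \<inter> \<Inter>\<G>"
          using fin[OF \<open>finite \<G>\<close> \<open>\<G> \<subseteq> \<D>\<close>] by blast
        then have "K \<noteq> {}" using D(1) assms(2)[of K] by blast
        then show ?thesis using K(2) by blast
      qed
    qed
    then have "\<Inter>\<D> \<in> \<F>" using D by (intro Inter) blast+
    moreover have "\<Union>\<C> = - \<Inter>\<D>" by (auto simp: \<D>_def)
    ultimately show "\<Union>\<C> \<in> uminus ` \<F>" by blast
  qed
  then obtain M where M: "M \<in> \<F>" "\<forall>K\<in>\<F>. - M \<subseteq> - K \<longrightarrow> - K = - M" by auto
  show thesis
    by (rule that[OF M(1)]) (use M(2) in blast)
qed

text \<open>Take a minimal compact subsemigroup \<open>M\<close> and \<open>u\<close> in it. The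
  right translate of \<open>M\<close> by \<open>u\<close> is a compact subsemigroup of
  \<open>M\<close>, hence all of \<open>M\<close>, so \<open>v \<circ> u = u\<close> has a solution
  in \<open>M\<close>. The solutions again form a compact subsemigroup, hence all of
  \<open>M\<close>, and \<open>u\<close> itself is one of them.\<close>

lemma ellis_namakura_idempotent:
  fixes S :: "('a \<Rightarrow> 'a::metric_space) set"
  assumes "compact S" "S \<noteq> {}" and mult: "\<And>p q. \<lbrakk>p \<in> S; q \<in> S\<rbrakk> \<Longrightarrow> p \<circ> q \<in> S"
  obtains u where "u \<in> S" "u \<circ> u = u"
proof -
  define \<F> where "\<F> = {K. K \<subseteq> S \<and> compact K \<and> K \<noteq> {} \<and> (\<forall>p\<in>K. \<forall>q\<in>K. p \<circ> q \<in> K)}"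
  have cpt: "compact K \<and> closed K \<and> K \<noteq> {}" if "K \<in> \<F>" for K
    using that compact_imp_closed_fun by (auto simp: \<F>_def)
  have Inter: "\<Inter>\<C> \<in> \<F>" if "\<C> \<noteq> {}" "\<C> \<subseteq> \<F>" "\<Inter>\<C> \<noteq> {}" for \<C>
  proof -
    obtain K where K: "K \<in> \<C>" using \<open>\<C> \<noteq> {}\<close> by blast
    have "closed (\<Inter>\<C>)" using that cpt by (intro closed_Inter) blast
    moreover have "compact K" using K that cpt by blast
    ultimately have "compact (\<Inter>\<C> \<inter> K)" by (rule closed_Int_compact)
    moreover have "\<Inter>\<C> \<inter> K = \<Inter>\<C>" using K by blast
    ultimately have "compact (\<Inter>\<C>)" by simp
    moreover have "p \<circ> q \<in> \<Inter>\<C>" if "p \<in> \<Inter>\<C>" "q \<in> \<Inter>\<C>" for p q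
      using that \<open>\<C> \<subseteq> \<F>\<close> by (auto simp: \<F>_def)
    moreover have "\<Inter>\<C> \<subseteq> S"
    proof -
      have "K \<subseteq> S" using K \<open>\<C> \<subseteq> \<F>\<close> unfolding \<F>_def by blast
      then show ?thesis using K by blast
    qed
    ultimately show ?thesis using \<open>\<Inter>\<C> \<noteq> {}\<close> unfolding \<F>_def by blast
  qed
  have "S \<in> \<F>" using assms by (auto simp: \<F>_def)
  then obtain M where M: "M \<in> \<F>" and min: "\<And>K. \<lbrakk>K \<in> \<F>; K \<subseteq> M\<rbrakk> \<Longrightarrow> K = M"
    by (rule compact_minimal_subset[OF _ cpt Inter]) auto
  then have M': "M \<subseteq> S" "compact M" "M \<noteq> {}" "\<And>p q. \<lbrakk>p \<in> M; q \<in> M\<rbrakk> \<Longrightarrow> p \<circ> q \<in> M"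
    by (auto simp: \<F>_def)
  obtain u where u: "u \<in> M" using M' by blast
  have "(\<lambda>p. p \<circ> u) ` M \<in> \<F>"
    unfolding \<F>_def
  proof (intro CollectI conjI ballI)
    show "compact ((\<lambda>p. p \<circ> u) ` M)"
      using M' by (intro compact_continuous_image continuous_on_comp_right_fun)
    fix p q assume "p \<in> (\<lambda>p. p \<circ> u) ` M" "q \<in> (\<lambda>p. p \<circ> u) ` M"
    then obtain p' q' where "p' \<in> M" "q' \<in> M" "p = p' \<circ> u" "q = q' \<circ> u" by auto
    then show "p \<circ> q \<in> (\<lambda>p. p \<circ> u) ` M"
      by (intro image_eqI[of _ _ "p' \<circ> u \<circ> q'"]) (auto simp: comp_assoc u intro!: M'(4))
  qed (use M' u in auto)
  then have "(\<lambda>p. p \<circ> u) ` M = M"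
    using M' u by (intro min) auto
  with u have "u \<in> (\<lambda>p. p \<circ> u) ` M" by blast
  then obtain v where v: "v \<in> M" "v \<circ> u = u" unfolding image_iff by metis
  define V where "V = M \<inter> (\<lambda>p. p \<circ> u) -` {u}"
  have "closed {u}"
    by (intro compact_imp_closed_fun finite_imp_compact finite.intros)
  moreover have "continuous_on UNIV (\<lambda>p. p \<circ> u)"
    by (rule continuous_on_comp_right_fun)
  ultimately have "closed ((\<lambda>p. p \<circ> u) -` {u})"
    by (rule closed_vimage)
  then have "compact V" unfolding V_def using M' by (intro compact_Int_closed)
  moreover have "p \<circ> q \<in> V" if "p \<in> V" "q \<in> V" for p q
    using that M'(4)[of p q] by (auto simp: V_def comp_assoc)
  ultimately have "V \<in> \<F>" using v M' by (auto simp: \<F>_def V_def)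
  then have "V = M" by (intro min) (auto simp: V_def)
  then show thesis using that u M' by (auto simp: V_def)
qed

section \<open>Points over which a map is open\<close>

text \<open>Equivalently, the set-valued map sending a point of the image to its fiber in
  \<open>K\<close> is lower semicontinuous at \<open>y\<close>.\<close>

definition open_along_fiber ::
    "'a::metric_space set \<Rightarrow> ('a \<Rightarrow> 'b::metric_space) \<Rightarrow> 'b \<Rightarrow> bool" where
  "open_along_fiber K f y \<longleftrightarrow>
     (\<forall>z\<in>K. f z = y \<longrightarrow> (\<forall>e>0. \<exists>U. open U \<and> y \<in> U \<and> U \<inter> f ` K \<subseteq> f ` (K \<inter> ball z e)))"

text \<open>Countably many closed balls around finite nets of \<open>K\<close> have closed images in
  \<open>Y\<close>, whose boundaries are nowhere dense. By Baire some \<open>y\<close> avoids all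
  these boundaries, so it is interior to every such image that contains it.\<close>

lemma exists_open_fiber:
  fixes f :: "'a::metric_space \<Rightarrow> 'b::metric_space"
  assumes K: "compact K" and f: "continuous_on K f" and Y: "f ` K = Y" "Y \<noteq> {}"
  obtains y where "y \<in> Y" "open_along_fiber K f y"
proof -
  have "\<exists>C. finite C \<and> C \<subseteq> K \<and> K \<subseteq> (\<Union>c\<in>C. ball c (1 / Suc n))" for n
  proof -
    have "K \<subseteq> (\<Union>c\<in>K. ball c (1 / Suc n))" by auto
    then show ?thesis
      using compactE_image[OF K, of K "\<lambda>c. ball c (1 / Suc n)"] by (metis open_ball)
  qed
  then obtain C where C: "\<And>n. finite (C n)" "\<And>n. C n \<subseteq> K" "\<And>n. K \<subseteq> (\<Union>c\<in>C n. ball c (1 / Suc n))"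
    by metis
  define Q where "Q = (\<lambda>(n, c). f ` (K \<inter> cball c (1 / Suc n)))"
  let ?Y = "top_of_set Y"
  have cptY: "compact Y" using K f Y compact_continuous_image by blast
  \<comment> \<open>Each \<open>Q i\<close> is closed in \<open>Y\<close>, so these differences are
    its relative boundary.\<close>
  define \<G> where "\<G> = (\<lambda>i. Q i - ?Y interior_of Q i) ` (SIGMA n:UNIV. C n)"
  have "?Y interior_of \<Union>\<G> = {}"
  proof (rule Baire_category_alt)
    show "completely_metrizable_space ?Y \<or> locally_compact_space ?Y \<and> regular_space ?Y"
    proof -
      have "compact_space ?Y" using cptY by (simp add: compact_space_subtopology)
      moreover have "regular_space ?Y"
        by (intro metrizable_imp_regular_space metrizable_space_subtopology metrizable_space_euclidean)
      ultimately show ?thesis using compact_imp_locally_compact_space by blast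
    qed
    show "countable \<G>"
      unfolding \<G>_def using C(1) by (intro countable_image countable_SIGMA) (auto intro: countable_finite)
    fix S assume "S \<in> \<G>"
    then obtain i where i: "S = Q i - ?Y interior_of Q i" by (auto simp: \<G>_def)
    have "compact (Q i)"
      unfolding Q_def using K f
      by (auto split: prod.split intro!: compact_continuous_image compact_Int_closed intro: continuous_on_subset)
    then have cl: "closedin ?Y (Q i)"
      using Y by (intro closed_subset compact_imp_closed) (auto simp: Q_def split: prod.splits)
    show "closedin ?Y S \<and> ?Y interior_of S = {}"
    proof
      show "closedin ?Y S" unfolding i using cl by (intro closedin_diff) auto
      have "?Y interior_of S \<subseteq> ?Y interior_of Q i" unfolding i by (intro interior_of_mono) auto
      moreover have "?Y interior_of S \<subseteq> S" by (rule interior_of_subset)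
      ultimately show "?Y interior_of S = {}" unfolding i by blast
    qed
  qed
  then have "\<not> Y \<subseteq> \<Union>\<G>"
    using Y by (metis interior_of_maximal openin_topspace subset_empty topspace_euclidean_subtopology)
  then obtain y where y: "y \<in> Y" "y \<notin> \<Union>\<G>" by blast
  show thesis
  proof (rule that[OF y(1)], unfold open_along_fiber_def, intro ballI allI impI)
    fix z and e :: real assume z: "z \<in> K" "f z = y" "e > 0"
    \<comment> \<open>With radius below \<open>e / 2\<close>, a closed ball of the net that contains
      \<open>z\<close> lies inside \<open>ball z e\<close>.\<close>
    obtain n where n: "1 / Suc n < e / 2"
      using z nat_approx_posE[of "e/2"] by auto
    obtain c where c: "c \<in> C n" "dist c z < 1 / Suc n"
      using C(3)[of n] z by auto
    have "y \<in> Q (n, c)"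
      unfolding Q_def using z c by (auto simp: less_imp_le)
    moreover have "Q (n, c) - ?Y interior_of Q (n, c) \<in> \<G>"
      unfolding \<G>_def using c by auto
    ultimately have "y \<in> ?Y interior_of Q (n, c)" using y by blast
    moreover obtain U where U: "open U" "?Y interior_of Q (n, c) = Y \<inter> U"
      using openin_interior_of[of ?Y] by (metis openin_open)
    moreover have "Q (n, c) \<subseteq> f ` (K \<inter> ball z e)"
    proof -
      have "dist z x < e" if "dist c x \<le> 1 / Suc n" for x
        using that c n dist_triangle[of z x c] by (simp add: dist_commute)
      then show ?thesis by (auto simp: Q_def)
    qed
    ultimately show "\<exists>U. open U \<and> y \<in> U \<and> U \<inter> f ` K \<subseteq> f ` (K \<inter> ball z e)"
      unfolding Y(1) using interior_of_subset[of ?Y "Q (n, c)"] by (intro exI[of _ U]) blast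
  qed
qed

section \<open>The Ellis semigroup of a minimal flow\<close>

text \<open>As the group is discrete, joint continuity reduces to continuity of each
  \<open>\<alpha> g\<close>; bijectivity comes from the inverse group element. This serves for orbit
  closures in powers of \<open>X\<close>.\<close>

lemma flow_restrictI:
  fixes C :: "'c::metric_space set"
  assumes T: "group T" and C: "compact C"
    and cont: "\<And>g. g \<in> carrier T \<Longrightarrow> continuous_on C (\<alpha> g)"
    and img: "\<And>g z. \<lbrakk>g \<in> carrier T; z \<in> C\<rbrakk> \<Longrightarrow> \<alpha> g z \<in> C"
    and mult: "\<And>g h z. \<lbrakk>g \<in> carrier T; h \<in> carrier T; z \<in> C\<rbrakk> \<Longrightarrow> \<alpha> (g \<otimes>\<^bsub>T\<^esub> h) z = \<alpha> g (\<alpha> h z)"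
    and one: "\<And>z. z \<in> C \<Longrightarrow> \<alpha> \<one>\<^bsub>T\<^esub> z = z"
  shows "flow T C (\<lambda>g. restrict (\<alpha> g) C)"
proof -
  interpret group T by fact
  have inv: "\<alpha> (inv\<^bsub>T\<^esub> g) (\<alpha> g z) = z" "\<alpha> g (\<alpha> (inv\<^bsub>T\<^esub> g) z) = z" if "g \<in> carrier T" "z \<in> C" for g z
    using that mult[of g "inv\<^bsub>T\<^esub> g" z] mult[of "inv\<^bsub>T\<^esub> g" g z] by (auto simp: one)
  have Bij: "restrict (\<alpha> g) C \<in> Bij C" if "g \<in> carrier T" for g
    unfolding Bij_def using that
    by (auto intro!: bij_betw_byWitness[where f' = "\<alpha> (inv\<^bsub>T\<^esub> g)"] simp: inv img)
  have "group_hom T (BijGroup C) (\<lambda>g. restrict (\<alpha> g) C)"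
  proof (intro group_hom.intro group_hom_axioms.intro homI T group_BijGroup)
    fix g h assume gh: "g \<in> carrier T" "h \<in> carrier T"
    show "restrict (\<alpha> g) C \<in> carrier (BijGroup C)"
      using Bij gh by (simp add: BijGroup_def)
    show "restrict (\<alpha> (g \<otimes>\<^bsub>T\<^esub> h)) C = restrict (\<alpha> g) C \<otimes>\<^bsub>BijGroup C\<^esub> restrict (\<alpha> h) C"
      using Bij gh by (auto simp: BijGroup_def compose_def fun_eq_iff mult img)
  qed
  then have "group_action T C (\<lambda>g. restrict (\<alpha> g) C)"
    by (simp add: group_action_def)
  moreover have "continuous_map (prod_topology (discrete_topology (carrier T)) (top_of_set C))
       (top_of_set C) (\<lambda>(g, x). restrict (\<alpha> g) C x)"
    unfolding continuous_map_def
  proof (intro conjI allI impI)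
    show "(\<lambda>(g, x). restrict (\<alpha> g) C x) \<in> topspace (prod_topology (discrete_topology (carrier T)) (top_of_set C)) \<rightarrow> topspace (top_of_set C)"
      by (auto simp: img)
    fix U assume U: "openin (top_of_set C) U"
    \<comment> \<open>The preimage splits into slices over the single group elements, and each
      singleton is open in the discrete topology.\<close>
    have "{x \<in> topspace (prod_topology (discrete_topology (carrier T)) (top_of_set C)).
           (case x of (g, x) \<Rightarrow> restrict (\<alpha> g) C x) \<in> U} = (\<Union>g\<in>carrier T. {g} \<times> (C \<inter> \<alpha> g -` U))"
      by auto
    also have "openin (prod_topology (discrete_topology (carrier T)) (top_of_set C)) \<dots>"
    proof (intro openin_Union, clarify)
      fix g assume g: "g \<in> carrier T"
      have "openin (top_of_set C) (C \<inter> \<alpha> g -` U)"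
        using continuous_openin_preimage[OF cont[OF g], of C U] U img g by auto
      then show "openin (prod_topology (discrete_topology (carrier T)) (top_of_set C)) ({g} \<times> (C \<inter> \<alpha> g -` U))"
        using g by (simp add: openin_prod_Times_iff)
    qed
    finally show "openin (prod_topology (discrete_topology (carrier T)) (top_of_set C))
      {x \<in> topspace (prod_topology (discrete_topology (carrier T)) (top_of_set C)).
           (case x of (g, x) \<Rightarrow> restrict (\<alpha> g) C x) \<in> U}" .
  qed
  ultimately show ?thesis using C by (simp add: flow_def)
qed


locale minimal_system =
  fixes T :: "('g, 'm) monoid_scheme" and X :: "'a::metric_space set" and \<phi> :: "'g \<Rightarrow> 'a \<Rightarrow> 'a"
  assumes T: "group T" and minimal: "minimal_flow T X \<phi>"
begin

sublocale group T by (rule T)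

lemma X_flow: "flow T X \<phi>" and X_minimal: "x \<in> X \<Longrightarrow> X \<subseteq> closure (orbit T \<phi> x)"
  using minimal by (auto simp: minimal_flow_def)

sublocale group_action T X \<phi>
  using X_flow by (simp add: flow_def)

lemma compact_X: "compact X"
  using X_flow by (simp add: flow_def)

lemma continuous_on_phi:
  assumes "g \<in> carrier T"
  shows "continuous_on X (\<phi> g)"
proof -
  have "continuous_map (top_of_set X) (prod_topology (discrete_topology (carrier T)) (top_of_set X)) (\<lambda>x. (g, x))"
    using assms by (intro continuous_map_pairedI) auto
  from continuous_map_compose[OF this] X_flow
  have "continuous_map (top_of_set X) (top_of_set X) ((\<lambda>(g, x). \<phi> g x) \<circ> (\<lambda>x. (g, x)))"
    unfolding flow_def by blast
  then show ?thesis by (simp add: comp_def continuous_map_in_subtopology)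
qed

lemma phi_one: "x \<in> X \<Longrightarrow> \<phi> \<one>\<^bsub>T\<^esub> x = x"
  by (simp flip: id_eq_one)

lemma phi_in_X: "\<lbrakk>g \<in> carrier T; x \<in> X\<rbrakk> \<Longrightarrow> \<phi> g x \<in> X"
  by (rule element_image) auto

lemma phi_inv: "\<lbrakk>g \<in> carrier T; x \<in> X\<rbrakk> \<Longrightarrow> \<phi> (inv\<^bsub>T\<^esub> g) (\<phi> g x) = x"
  using composition_rule[of x "inv\<^bsub>T\<^esub> g" g] by (simp add: phi_one)

text \<open>
  The Ellis semigroup is taken inside the full function space, which is a semigroup under
  composition, so the maps of the action are extended by the identity off \<open>X\<close>.
\<close>

definition act :: "'g \<Rightarrow> 'a \<Rightarrow> 'a" where
  "act g = (\<lambda>x. if x \<in> X then \<phi> g x else x)"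

definition ellis :: "('a \<Rightarrow> 'a) set" where
  "ellis = closure (act ` carrier T)"

text \<open>This encodes minimality of the orbit closure of the tuple of all points of
  \<open>A\<close>: wherever \<open>p\<close> moves the tuple, some \<open>q\<close> leads it back.
  No enumeration of \<open>A\<close> is involved.\<close>

definition jointly_minimal :: "'a set \<Rightarrow> bool" where
  "jointly_minimal A \<longleftrightarrow> (\<forall>p\<in>ellis. \<exists>q\<in>ellis. \<forall>a\<in>A. q (p a) = a)"

lemma act_mult: "\<lbrakk>g \<in> carrier T; h \<in> carrier T\<rbrakk> \<Longrightarrow> act (g \<otimes>\<^bsub>T\<^esub> h) = act g \<circ> act h"
  by (auto simp: act_def fun_eq_iff composition_rule phi_in_X)

lemma act_in_ellis: "g \<in> carrier T \<Longrightarrow> act g \<in> ellis"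
  unfolding ellis_def by (rule subsetD[OF closure_subset]) simp

lemma act_eq: "x \<in> X \<Longrightarrow> act g x = \<phi> g x"
  by (simp add: act_def)

text \<open>A compact box around the Ellis semigroup; the singleton factors match the extension of
  the action by the identity off \<open>X\<close>.\<close>

definition self_maps :: "('a \<Rightarrow> 'a) set" where
  "self_maps = (\<Pi> x\<in>UNIV. if x \<in> X then X else {x})"

lemma self_maps_iff: "p \<in> self_maps \<longleftrightarrow> (\<forall>x\<in>X. p x \<in> X) \<and> (\<forall>x. x \<notin> X \<longrightarrow> p x = x)"
  by (auto simp: self_maps_def Pi_iff split: if_splits)

lemma compact_self_maps: "compact self_maps"
  unfolding self_maps_def by (rule compact_Pi_UNIV) (simp add: compact_X)

lemma ellis_subset: "ellis \<subseteq> self_maps"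
  unfolding ellis_def
proof (rule closure_minimal)
  show "act ` carrier T \<subseteq> self_maps"
    by (auto simp: self_maps_iff act_def phi_in_X)
  show "closed self_maps"
    by (intro compact_imp_closed_fun compact_self_maps)
qed

lemma compact_ellis: "compact ellis"
proof -
  have "compact (ellis \<inter> self_maps)"
    by (intro closed_Int_compact compact_self_maps) (simp add: ellis_def)
  then show ?thesis using ellis_subset by (simp add: Int_absorb2)
qed

lemma ellis_in_X: "\<lbrakk>p \<in> ellis; x \<in> X\<rbrakk> \<Longrightarrow> p x \<in> X"
  using subsetD[OF ellis_subset, of p] by (simp add: self_maps_iff)

lemma ellis_closed_induct:
  assumes "p \<in> ellis" "closed S" "\<And>g. g \<in> carrier T \<Longrightarrow> act g \<in> S"
  shows "p \<in> S"
proof -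
  have "act ` carrier T \<subseteq> S" using assms(3) by auto
  then have "ellis \<subseteq> S" unfolding ellis_def using assms(2) by (rule closure_minimal)
  then show ?thesis using assms(1) by auto
qed

text \<open>Coordinates in \<open>X\<close> keep their values in \<open>X\<close>, where
  \<open>\<phi> g\<close> is continuous, and all other coordinates are constant. Hence the
  restriction to \<open>self_maps\<close>: \<open>act g\<close> need not be continuous on the whole
  type.\<close>

lemma continuous_on_act_comp:
  assumes g: "g \<in> carrier T"
  shows "continuous_on self_maps (\<lambda>q. act g \<circ> q)"
  unfolding comp_def
proof (rule continuous_on_coordinatewise_then_product)
  fix x
  have x: "continuous_on self_maps (\<lambda>q. q x)"
    by (rule continuous_on_subset[OF continuous_on_product_coordinates]) simp
  show "continuous_on self_maps (\<lambda>q. act g (q x))"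
  proof (cases "x \<in> X")
    case True
    then have X: "q x \<in> X" if "q \<in> self_maps" for q using that by (simp add: self_maps_iff)
    then have "continuous_on self_maps (\<lambda>q. \<phi> g (q x))"
      by (intro continuous_on_compose2[OF continuous_on_phi[OF g] x]) auto
    then show ?thesis
      by (rule continuous_on_eq) (simp add: act_eq X)
  next
    case False
    then have "q x = x" if "q \<in> self_maps" for q using that by (simp add: self_maps_iff)
    then have "act g x = act g (q x)" if "q \<in> self_maps" for q using that by metis
    then show ?thesis
      by (intro continuous_on_eq[OF continuous_on_const, of _ "act g x"])
  qed
qed

text \<open>Two closure arguments, in this order: left composition with \<open>act g\<close> is
  continuous, which settles \<open>act g \<circ> q\<close>; then right composition with
  \<open>q\<close> is continuous, which allows passing from \<open>act g\<close> to
  \<open>p\<close>.\<close>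

lemma ellis_comp:
  assumes p: "p \<in> ellis" and q: "q \<in> ellis"
  shows "p \<circ> q \<in> ellis"
proof -
  have cl: "closed ellis" by (simp add: ellis_def)
  have 1: "act g \<circ> q \<in> ellis" if g: "g \<in> carrier T" for g
  proof -
    have "q \<in> self_maps \<inter> (\<lambda>q. act g \<circ> q) -` ellis"
    proof (rule ellis_closed_induct[OF q])
      show "closed (self_maps \<inter> (\<lambda>q. act g \<circ> q) -` ellis)"
        by (intro continuous_closed_preimage continuous_on_act_comp g cl
              compact_imp_closed_fun compact_self_maps)
      fix h assume h: "h \<in> carrier T"
      have "act g \<circ> act h = act (g \<otimes>\<^bsub>T\<^esub> h)" using act_mult g h by simp
      then show "act h \<in> self_maps \<inter> (\<lambda>q. act g \<circ> q) -` ellis"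
        using g h act_in_ellis ellis_subset by auto
    qed
    then show ?thesis by simp
  qed
  have "p \<in> (\<lambda>p. p \<circ> q) -` ellis"
    by (rule ellis_closed_induct[OF p closed_vimage[OF cl continuous_on_comp_right_fun]])
      (simp add: 1)
  then show ?thesis by simp
qed

lemma ellis_approx:
  assumes "p \<in> ellis" "finite B" "e > 0"
  obtains g where "g \<in> carrier T" "\<And>b. b \<in> B \<Longrightarrow> dist (act g b) (p b) < e"
proof -
  have "open {q. \<forall>b\<in>B. q b \<in> ball (p b) e}"
    using product_topology_basis'[of B "\<lambda>b. ball (p b) e" "\<lambda>b. b"] assms by simp
  moreover have "p \<in> {q. \<forall>b\<in>B. q b \<in> ball (p b) e}" using assms by simp
  ultimately have "act ` carrier T \<inter> {q. \<forall>b\<in>B. q b \<in> ball (p b) e} \<noteq> {}"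
    using assms(1) open_Int_closure_eq_empty[of "{q. \<forall>b\<in>B. q b \<in> ball (p b) e}" "act ` carrier T"]
    unfolding ellis_def by blast
  then obtain g where "g \<in> carrier T" "\<forall>b\<in>B. act g b \<in> ball (p b) e" by blast
  then show thesis using that[of g] by (simp add: dist_commute)
qed

text \<open>With \<open>F\<close> an evaluation map, this describes orbit closures in
  \<open>X\<close> and in its powers through \<open>ellis\<close>.\<close>

lemma ellis_image_eq_closure:
  fixes F :: "('a \<Rightarrow> 'a) \<Rightarrow> 'c::metric_space"
  assumes "continuous_on ellis F"
  shows "F ` ellis = closure ((\<lambda>g. F (act g)) ` carrier T)"
proof
  have "F ` closure (act ` carrier T) \<subseteq> closure (F ` act ` carrier T)"
    using assms continuous_image_closure_subset[of ellis F "act ` carrier T"]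
    unfolding ellis_def by blast
  then show "F ` ellis \<subseteq> closure ((\<lambda>g. F (act g)) ` carrier T)"
    by (simp add: ellis_def image_image)
  show "closure ((\<lambda>g. F (act g)) ` carrier T) \<subseteq> F ` ellis"
    using assms by (intro closure_minimal compact_imp_closed compact_continuous_image compact_ellis)
      (auto intro: act_in_ellis)
qed

lemma continuous_on_eval: "continuous_on S (\<lambda>p :: 'a \<Rightarrow> 'a. p x)"
  by (rule continuous_on_subset[OF continuous_on_product_coordinates]) simp

lemma ellis_transitive:
  assumes "x \<in> X" "x' \<in> X"
  obtains p where "p \<in> ellis" "p x = x'"
proof -
  have "orbit T \<phi> x = (\<lambda>g. act g x) ` carrier T"
    using assms by (auto simp: orbit_def act_eq)
  then have "closure (orbit T \<phi> x) = (\<lambda>p. p x) ` ellis"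
    using ellis_image_eq_closure[OF continuous_on_eval, of x] by simp
  then have "x' \<in> (\<lambda>p. p x) ` ellis" using X_minimal[OF assms(1)] assms(2) by auto
  then show thesis using that by auto
qed

section \<open>Jointly minimal sets, proximal pairs and minimal idempotents\<close>

lemma jointly_minimal_image:
  assumes "jointly_minimal A" "p \<in> ellis"
  shows "jointly_minimal (p ` A)" "inj_on p A"
proof -
  show "jointly_minimal (p ` A)"
    unfolding jointly_minimal_def
  proof
    fix r assume "r \<in> ellis"
    then have "r \<circ> p \<in> ellis" using assms ellis_comp by blast
    then obtain q where "q \<in> ellis" "\<forall>a\<in>A. q ((r \<circ> p) a) = a"
      using assms unfolding jointly_minimal_def by blast
    \<comment> \<open>\<open>q\<close> leads \<open>r (p a)\<close> back to \<open>a\<close>, and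
      \<open>p\<close> then restores \<open>p a\<close>.\<close>
    then show "\<exists>q\<in>ellis. \<forall>a\<in>p ` A. q (r a) = a"
      using ellis_comp[OF assms(2), of q] by (intro bexI[of _ "p \<circ> q"]) auto
  qed
  obtain q where "\<forall>a\<in>A. q (p a) = a"
    using assms unfolding jointly_minimal_def by blast
  then show "inj_on p A" by (metis inj_onI)
qed

lemma jointly_minimal_singleton:
  assumes "x \<in> X"
  shows "jointly_minimal {x}"
  unfolding jointly_minimal_def
proof
  fix p assume "p \<in> ellis"
  then obtain q where "q \<in> ellis" "q (p x) = x"
    using ellis_transitive[of "p x" x] ellis_in_X assms by blast
  then show "\<exists>q\<in>ellis. \<forall>a\<in>{x}. q (p a) = a" by blast
qed

text \<open>The distance of the two images depends continuously on \<open>p\<close>, so it attains a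
  minimum on the compact \<open>ellis\<close>, and density of the group makes this the infimum over
  the group.\<close>

lemma proximal_iff:
  assumes "x \<in> X" "x' \<in> X"
  shows "proximal T \<phi> x x' \<longleftrightarrow> (\<exists>p\<in>ellis. p x = p x')"
proof
  assume "\<exists>p\<in>ellis. p x = p x'"
  then obtain p where p: "p \<in> ellis" "p x = p x'" by blast
  have bdd: "bdd_below ((\<lambda>g. dist (\<phi> g x) (\<phi> g x')) ` carrier T)"
    by (rule bdd_belowI[of _ 0]) auto
  have "(INF g\<in>carrier T. dist (\<phi> g x) (\<phi> g x')) \<le> 0 + e" if "e > 0" for e
  proof -
    have "finite {x, x'}" "e / 2 > 0" using that by auto
    then obtain g where g: "g \<in> carrier T" "\<And>b. b \<in> {x, x'} \<Longrightarrow> dist (act g b) (p b) < e / 2"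
      using ellis_approx[OF p(1)] by metis
    have "dist (\<phi> g x) (\<phi> g x') \<le> dist (\<phi> g x) (p x) + dist (\<phi> g x') (p x)"
      by (rule dist_triangle2)
    also have "\<dots> < e" using g(2)[of x] g(2)[of x'] p(2) assms by (simp add: act_eq)
    finally show ?thesis using cINF_lower[OF bdd g(1)] by simp
  qed
  then have "(INF g\<in>carrier T. dist (\<phi> g x) (\<phi> g x')) \<le> 0" by (rule field_le_epsilon)
  moreover have "0 \<le> (INF g\<in>carrier T. dist (\<phi> g x) (\<phi> g x'))"
    by (rule cINF_greatest) (use one_closed in auto)
  ultimately show "proximal T \<phi> x x'" by (simp add: proximal_def)
next
  assume prox: "proximal T \<phi> x x'"
  have "continuous_on ellis (\<lambda>p. dist (p x) (p x'))"
    by (intro continuous_on_dist continuous_on_eval)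
  moreover have "ellis \<noteq> {}" using act_in_ellis one_closed by blast
  ultimately obtain p where p: "p \<in> ellis" "\<And>q. q \<in> ellis \<Longrightarrow> dist (p x) (p x') \<le> dist (q x) (q x')"
    using continuous_attains_inf[OF compact_ellis] by blast
  have "dist (p x) (p x') \<le> (INF g\<in>carrier T. dist (\<phi> g x) (\<phi> g x'))"
  proof (rule cINF_greatest)
    show "dist (p x) (p x') \<le> dist (\<phi> g x) (\<phi> g x')" if "g \<in> carrier T" for g
      using p(2)[OF act_in_ellis[OF that]] assms by (simp add: act_eq)
  qed (use one_closed in auto)
  then have "p x = p x'" using prox by (simp add: proximal_def)
  then show "\<exists>p\<in>ellis. p x = p x'" using p by blast
qed

text \<open>The last clause says that \<open>u\<close> generates a minimal left ideal.\<close>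

lemma minimal_idempotent:
  assumes "jointly_minimal B"
  obtains u where "u \<in> ellis" "u \<circ> u = u" "\<And>b. b \<in> B \<Longrightarrow> u b = b"
    "\<And>r. r \<in> ellis \<Longrightarrow> \<exists>q\<in>ellis. q \<circ> r \<circ> u = u"
proof -
  \<comment> \<open>The compact left ideals of \<open>ellis\<close>.\<close>
  define \<F> where "\<F> = {L. L \<subseteq> ellis \<and> compact L \<and> L \<noteq> {} \<and> (\<forall>p\<in>L. \<forall>q\<in>ellis. q \<circ> p \<in> L)}"
  have cpt: "compact K \<and> closed K \<and> K \<noteq> {}" if "K \<in> \<F>" for K
    using that compact_imp_closed_fun by (auto simp: \<F>_def)
  have Inter: "\<Inter>\<C> \<in> \<F>" if "\<C> \<noteq> {}" "\<C> \<subseteq> \<F>" "\<Inter>\<C> \<noteq> {}" for \<C>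
  proof -
    obtain K where K: "K \<in> \<C>" using \<open>\<C> \<noteq> {}\<close> by blast
    have sub: "\<Inter>\<C> \<subseteq> ellis"
    proof -
      have "K \<subseteq> ellis" using K \<open>\<C> \<subseteq> \<F>\<close> unfolding \<F>_def by blast
      then show ?thesis using K by blast
    qed
    have "closed (\<Inter>\<C>)" using that cpt by (intro closed_Inter) blast
    then have "compact (\<Inter>\<C> \<inter> ellis)" using compact_ellis by (rule closed_Int_compact)
    then have "compact (\<Inter>\<C>)" using sub by (simp add: Int_absorb2)
    moreover have "q \<circ> p \<in> \<Inter>\<C>" if "p \<in> \<Inter>\<C>" "q \<in> ellis" for p q
      using that \<open>\<C> \<subseteq> \<F>\<close> by (auto simp: \<F>_def)
    ultimately show ?thesis using sub \<open>\<Inter>\<C> \<noteq> {}\<close> unfolding \<F>_def by blast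
  qed
  have "ellis \<noteq> {}" using act_in_ellis one_closed by blast
  then have "ellis \<in> \<F>" using compact_ellis ellis_comp by (auto simp: \<F>_def)
  then obtain L where L: "L \<in> \<F>" and min: "\<And>K. \<lbrakk>K \<in> \<F>; K \<subseteq> L\<rbrakk> \<Longrightarrow> K = L"
    by (rule compact_minimal_subset[OF _ cpt Inter]) auto
  then have L': "L \<subseteq> ellis" "compact L" "L \<noteq> {}" "\<And>p q. \<lbrakk>p \<in> L; q \<in> ellis\<rbrakk> \<Longrightarrow> q \<circ> p \<in> L"
    by (auto simp: \<F>_def)
  \<comment> \<open>A subsemigroup of the minimal left ideal \<open>L\<close>. It is nonempty
    because any \<open>p\<close> in \<open>L\<close> is undone on \<open>B\<close> by some
    \<open>q\<close>, and \<open>q \<circ> p\<close> stays in \<open>L\<close>.\<close>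
  define S where "S = L \<inter> {p. \<forall>b\<in>B. p b = b}"
  have "{p. \<forall>b\<in>B. p b = b} = (\<Inter>b\<in>B. (\<lambda>p. p b) -` {b})" by auto
  moreover have "closed \<dots>"
    by (intro closed_INT ballI closed_vimage continuous_on_eval) auto
  ultimately have "compact S" unfolding S_def using L' by (intro compact_Int_closed) auto
  moreover have "S \<noteq> {}"
  proof -
    obtain p where p: "p \<in> L" using L' by blast
    then obtain q where "q \<in> ellis" "\<forall>b\<in>B. q (p b) = b"
      using assms L'(1) unfolding jointly_minimal_def by blast
    then have "q \<circ> p \<in> S" using L'(4) p by (simp add: S_def)
    then show ?thesis by blast
  qed
  moreover have "p \<circ> q \<in> S" if "p \<in> S" "q \<in> S" for p q
    using that L'(1) L'(4)[of q p] by (auto simp: S_def)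
  ultimately obtain u where u: "u \<in> S" "u \<circ> u = u"
    by (rule ellis_namakura_idempotent)
  then have uL: "u \<in> L" by (simp add: S_def)
  show thesis
  proof (rule that[OF _ u(2)])
    show "u \<in> ellis" using uL L' by blast
    show "u b = b" if "b \<in> B" for b using u that by (simp add: S_def)
    fix r assume r: "r \<in> ellis"
    \<comment> \<open>This left ideal lies in \<open>L\<close>, so by minimality it equals
      \<open>L\<close> and contains \<open>u\<close>.\<close>
    let ?K = "(\<lambda>q. q \<circ> (r \<circ> u)) ` ellis"
    have KL: "?K \<subseteq> L"
      using L'(4)[OF uL] ellis_comp r by (auto simp flip: comp_assoc)
    have "?K \<in> \<F>"
      unfolding \<F>_def
    proof (intro CollectI conjI ballI)
      show "compact ?K"
        by (intro compact_continuous_image continuous_on_comp_right_fun compact_ellis)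
      show "?K \<subseteq> ellis" "?K \<noteq> {}" using KL L' \<open>ellis \<noteq> {}\<close> by blast+
      fix p q assume "p \<in> ?K" "q \<in> ellis"
      then obtain p' where "p' \<in> ellis" "p = p' \<circ> (r \<circ> u)" by blast
      then show "q \<circ> p \<in> ?K"
        using ellis_comp[OF \<open>q \<in> ellis\<close>, of p'] by (intro image_eqI[of _ _ "q \<circ> p'"]) (auto simp: comp_assoc)
    qed
    then have "?K = L" using KL by (rule min)
    then have "u \<in> ?K" using uL by simp
    then obtain q where "q \<in> ellis" "u = q \<circ> (r \<circ> u)" by blast
    then show "\<exists>q\<in>ellis. q \<circ> r \<circ> u = u" by (intro bexI[of _ q]) (simp_all add: comp_assoc)
  qed
qed


section \<open>Minimal points of powers and almost periodic sets\<close>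

text \<open>The orbit closure of the tuple \<open>x\<close> consists of its images under
  \<open>ellis\<close>. It is minimal iff \<open>x\<close> can be reached again from each of them,
  that is, iff each \<open>p\<close> can be undone on the entries of \<open>x\<close>.\<close>

lemma minimal_point_iff:
  assumes x: "x \<in> {..<n} \<rightarrow>\<^sub>E X"
  shows "minimal_point T (power_space X n) (diagonal_action X \<phi> n) x \<longleftrightarrow> jointly_minimal (x ` {..<n})"
proof -
  let ?P = "power_space X n" and ?D = "diagonal_action X \<phi> n"
  \<comment> \<open>\<open>ev w p\<close> applies \<open>p\<close> to every entry of
    \<open>w\<close>; the restriction keeps the tuple \<open>undefined\<close> from \<open>n\<close>
    on, as \<open>power_space\<close> demands.\<close>
  define ev where "ev w p = (\<lambda>i\<in>{..<n}. p (w i))" for w :: "nat \<Rightarrow> 'a" and p :: "'a \<Rightarrow> 'a"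
  define C where "C = ev x ` ellis"
  have xP: "x \<in> ?P" using x by (simp add: power_space_def)
  have P: "w i \<in> X" if "w \<in> ?P" "i < n" for w i
    using that by (auto simp: power_space_def PiE_iff)
  have D: "?D g w = ev w (act g)" if "w \<in> ?P" for w g
    using that P[OF that] by (auto simp: diagonal_action_def ev_def act_eq fun_eq_iff)
  have evP: "ev w p \<in> ?P" if "w \<in> ?P" "p \<in> ellis" for w p
    using that P[OF that(1)] by (auto simp: power_space_def ev_def ellis_in_X)
  have ev_ev: "ev (ev w p) q = ev w (q \<circ> p)" for w p q
    by (auto simp: ev_def fun_eq_iff)
  have cont: "continuous_on S (ev w)" for S w
    unfolding ev_def restrict_def
  proof (rule continuous_on_coordinatewise_then_product)
    fix i show "continuous_on S (\<lambda>p :: 'a \<Rightarrow> 'a. if i \<in> {..<n} then p (w i) else undefined)"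
      by (cases "i < n") (simp_all add: continuous_on_eval)
  qed
  have orb: "closure (orbit T ?D w) = ev w ` ellis" if "w \<in> ?P" for w
  proof -
    have "orbit T ?D w = (\<lambda>g. ev w (act g)) ` carrier T"
      using D[OF that] by (auto simp: orbit_def)
    then show ?thesis using ellis_image_eq_closure[OF cont[of ellis w]] by simp
  qed
  have act_one: "act \<one>\<^bsub>T\<^esub> a = a" for a
    by (simp add: act_def phi_one)
  have ev_one: "ev w (act \<one>\<^bsub>T\<^esub>) = w" if "w \<in> ?P" for w
    using that by (auto simp: ev_def act_one power_space_def fun_eq_iff PiE_iff extensional_def)
  have CP: "C \<subseteq> ?P" unfolding C_def using evP[OF xP] by blast
  have xC: "x \<in> C"
    unfolding C_def using ev_one[OF xP] act_in_ellis[OF one_closed] by (metis image_eqI)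
  have OC: "orbit_closure T ?D x = C"
    unfolding orbit_closure_def C_def by (rule orb[OF xP])
  have DC: "?D g z \<in> C" if "g \<in> carrier T" "z \<in> C" for g z
  proof -
    obtain p where p: "p \<in> ellis" "z = ev x p" using \<open>z \<in> C\<close> by (auto simp: C_def)
    have "?D g z = ev z (act g)" using D that CP by blast
    then have "?D g z = ev x (act g \<circ> p)" using p ev_ev by simp
    then show ?thesis using ellis_comp[OF act_in_ellis[OF that(1)] p(1)] by (auto simp: C_def)
  qed
  have flow: "flow T C (\<lambda>g. restrict (?D g) C)"
  proof (rule flow_restrictI[OF T])
    show "compact C"
      unfolding C_def by (intro compact_continuous_image cont compact_ellis)
    show "continuous_on C (?D g)" if g: "g \<in> carrier T" for g
    proof (rule continuous_on_coordinatewise_then_product)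
      fix i
      have *: "?D g w i = (if i < n then \<phi> g (w i) else undefined)" if "w \<in> C" for w
        using that CP by (auto simp: diagonal_action_def)
      have "continuous_on C (\<lambda>w. w i)"
        by (rule continuous_on_subset[OF continuous_on_product_coordinates]) simp
      then have "continuous_on C (\<lambda>w. \<phi> g (w i))" if "i < n"
        using that P CP by (intro continuous_on_compose2[OF continuous_on_phi[OF g]]) auto
      then have "continuous_on C (\<lambda>w. if i < n then \<phi> g (w i) else undefined)"
        by (cases "i < n") simp_all
      then show "continuous_on C (\<lambda>w. ?D g w i)"
        by (rule continuous_on_eq) (simp add: *)
    qed
    show "?D (g \<otimes>\<^bsub>T\<^esub> h) z = ?D g (?D h z)" if "g \<in> carrier T" "h \<in> carrier T" "z \<in> C" for g h z
    proof -
      have "?D g (?D h z) = ev (ev z (act h)) (act g)"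
        using that CP D DC by (metis subsetD)
      then show ?thesis using that CP D[of z] act_mult by (auto simp: ev_ev)
    qed
    show "?D \<one>\<^bsub>T\<^esub> z = z" if "z \<in> C" for z
      using that CP D ev_one by (metis subsetD)
  qed (rule DC)
  have orbC: "closure (orbit T (\<lambda>g. restrict (?D g) C) z) = ev z ` ellis" if "z \<in> C" for z
  proof -
    have "orbit T (\<lambda>g. restrict (?D g) C) z = orbit T ?D z"
      using that by (auto simp: orbit_def)
    then show ?thesis using orb that CP by auto
  qed
  have ret: "ev x (q \<circ> p) = x \<longleftrightarrow> (\<forall>a\<in>x ` {..<n}. q (p a) = a)" for p q
    using x by (auto simp: ev_def fun_eq_iff PiE_iff extensional_def restrict_def)
  have "minimal_point T ?P ?D x \<longleftrightarrow> (\<forall>z\<in>C. C \<subseteq> ev z ` ellis)"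
    unfolding minimal_point_def minimal_flow_def OC using xP flow orbC by auto
  \<comment> \<open>Reaching \<open>x\<close> is enough, since all of \<open>C\<close> is reached
    from \<open>x\<close>.\<close>
  also have "\<dots> \<longleftrightarrow> (\<forall>z\<in>C. x \<in> ev z ` ellis)"
  proof (intro ball_cong refl iffI)
    show "x \<in> ev z ` ellis" if "C \<subseteq> ev z ` ellis" for z using that xC by blast
    fix z assume "x \<in> ev z ` ellis"
    then obtain q where q: "q \<in> ellis" "x = ev z q" by blast
    show "C \<subseteq> ev z ` ellis"
    proof
      fix w assume "w \<in> C"
      then obtain r where r: "r \<in> ellis" "w = ev x r" by (auto simp: C_def)
      then have "w = ev z (r \<circ> q)" using q ev_ev by simp
      then show "w \<in> ev z ` ellis" using ellis_comp[OF r(1) q(1)] by blast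
    qed
  qed
  also have "\<dots> \<longleftrightarrow> (\<forall>p\<in>ellis. \<exists>q\<in>ellis. ev x (q \<circ> p) = x)"
    by (auto simp: C_def ev_ev image_iff eq_commute)
  also have "\<dots> \<longleftrightarrow> jointly_minimal (x ` {..<n})"
    unfolding jointly_minimal_def ret ..
  finally show ?thesis .
qed

lemma jointly_minimal_mono: "\<lbrakk>jointly_minimal A; B \<subseteq> A\<rbrakk> \<Longrightarrow> jointly_minimal B"
  unfolding jointly_minimal_def by blast

text \<open>An enumeration enters \<open>minimal_point_iff\<close> only through its range, so finite
  subsets can replace injective tuples.\<close>

lemma almost_periodic_set_iff:
  "almost_periodic_set T X \<phi> A \<longleftrightarrow> A \<subseteq> X \<and> (\<forall>B. finite B \<and> B \<subseteq> A \<longrightarrow> jointly_minimal B)"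
proof (intro iffI conjI allI impI)
  assume ap: "almost_periodic_set T X \<phi> A"
  then show "A \<subseteq> X" by (simp add: almost_periodic_set_def)
  fix B assume B: "finite B \<and> B \<subseteq> A"
  then obtain f where f: "bij_betw f {..<card B} B"
    using ex_bij_betw_nat_finite[of B] by (auto simp: atLeast0LessThan)
  let ?x = "restrict f {..<card B}"
  have img: "?x ` {..<card B} = B" using f by (simp add: bij_betw_def)
  then have xA: "?x \<in> {..<card B} \<rightarrow>\<^sub>E A" using B by auto
  then have "minimal_point T (power_space X (card B)) (diagonal_action X \<phi> (card B)) ?x"
    using ap f by (auto simp: almost_periodic_set_def bij_betw_def inj_on_def)
  then show "jointly_minimal B"
    using minimal_point_iff[of ?x "card B"] xA img \<open>A \<subseteq> X\<close> by (auto simp: PiE_iff)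
next
  assume *: "A \<subseteq> X \<and> (\<forall>B. finite B \<and> B \<subseteq> A \<longrightarrow> jointly_minimal B)"
  show "almost_periodic_set T X \<phi> A"
    unfolding almost_periodic_set_def
  proof (intro conjI allI ballI impI)
    show "A \<subseteq> X" using * by blast
    fix n :: nat and x assume x: "x \<in> {..<n} \<rightarrow>\<^sub>E A"
    then have "x \<in> {..<n} \<rightarrow>\<^sub>E X" "x ` {..<n} \<subseteq> A" using * by (auto simp: PiE_iff)
    then show "minimal_point T (power_space X n) (diagonal_action X \<phi> n) x"
      using minimal_point_iff * by simp
  qed
qed

end

text \<open>The factor 2 identifies any two points of \<open>B\<close> that are within
  \<open>e\<close> of a common point.\<close>

lemma finite_separated:
  fixes B :: "'a::metric_space set"
  assumes "finite B"
  obtains e where "e > 0" "\<forall>x\<in>B. \<forall>x'\<in>B. dist x x' < 2 * e \<longrightarrow> x = x'"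
proof -
  have "\<exists>d>0. \<forall>x'\<in>B. x' \<noteq> x \<longrightarrow> d \<le> dist x x'" for x
    using finite_set_avoid[OF assms, of x] by auto
  then obtain d where d: "\<And>x. d x > 0" "\<And>x x'. \<lbrakk>x' \<in> B; x' \<noteq> x\<rbrakk> \<Longrightarrow> d x \<le> dist x x'"
    by metis
  \<comment> \<open>The inserted 1 gives the minimum a value when \<open>B\<close> is empty.\<close>
  define e where "e = Min (insert 1 (d ` B)) / 2"
  have le: "2 * e \<le> d x" if "x \<in> B" for x
    using that assms by (simp add: e_def)
  show thesis
  proof (rule that)
    show "e > 0" using assms d by (simp add: e_def)
    show "\<forall>x\<in>B. \<forall>x'\<in>B. dist x x' < 2 * e \<longrightarrow> x = x'"
    proof (intro ballI impI)
      fix x x' assume x: "x \<in> B" "x' \<in> B" "dist x x' < 2 * e"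
      then have "\<not> d x \<le> dist x x'" using le[of x] by linarith
      then show "x = x'" using d(2)[of x' x] x(2) by metis
    qed
  qed
qed

section \<open>Extensions\<close>

locale minimal_extension = minimal_system T X \<phi>
  for T :: "('g, 'm) monoid_scheme" and X :: "'a::metric_space set" and \<phi> +
  fixes Y :: "'b::metric_space set" and \<psi> :: "'g \<Rightarrow> 'b \<Rightarrow> 'b" and \<pi> :: "'a \<Rightarrow> 'b"
  assumes ext: "flow_extension T X \<phi> Y \<psi> \<pi>"
begin

lemma continuous_on_pi: "continuous_on X \<pi>" and pi_image: "\<pi> ` X = Y"
  and pi_phi: "\<lbrakk>g \<in> carrier T; x \<in> X\<rbrakk> \<Longrightarrow> \<pi> (\<phi> g x) = \<psi> g (\<pi> x)"
  using ext by (auto simp: flow_extension_def)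

text \<open>Equality of the two projections is a closed condition on \<open>p\<close> and holds for
  each \<open>act g\<close> by equivariance. Thus \<open>ellis\<close> maps fibers into
  fibers.\<close>

lemma pi_ellis:
  assumes "x \<in> X" "x' \<in> X" "\<pi> x = \<pi> x'" "p \<in> ellis"
  shows "\<pi> (p x) = \<pi> (p x')"
proof -
  define S where "S = self_maps \<inter> (\<lambda>q. dist (\<pi> (q x)) (\<pi> (q x'))) -` {0}"
  have "continuous_on self_maps (\<lambda>q. \<pi> (q z))" if "z \<in> X" for z
    by (rule continuous_on_compose2[OF continuous_on_pi continuous_on_eval])
      (use that in \<open>auto simp: self_maps_iff\<close>)
  then have "closed S"
    unfolding S_def using assms
    by (intro continuous_closed_preimage continuous_on_dist compact_imp_closed_fun compact_self_maps) auto
  moreover have "act g \<in> S" if "g \<in> carrier T" for g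
    using that assms subsetD[OF ellis_subset act_in_ellis]
    by (simp add: S_def act_eq pi_phi)
  ultimately have "p \<in> S" by (rule ellis_closed_induct[OF assms(4)])
  then show ?thesis by (simp add: S_def)
qed

text \<open>Continuity of \<open>\<pi>\<close> at \<open>p x\<close> gives a tolerance for the
  pointwise approximation that also puts the moved fiber over \<open>U\<close>.\<close>

lemma extension_approx:
  assumes p: "p \<in> ellis" and B: "finite B" "B \<subseteq> X" "x \<in> B"
    and U: "open U" "\<pi> (p x) \<in> U" and e: "e > 0"
  obtains g where "g \<in> carrier T" "\<pi> (\<phi> g x) \<in> U" "\<And>b. b \<in> B \<Longrightarrow> dist (\<phi> g b) (p b) < e"
proof -
  have x: "x \<in> X" "p x \<in> X" using B ellis_in_X[OF p] by auto
  obtain r where r: "r > 0" "ball (\<pi> (p x)) r \<subseteq> U" using U openE by blast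
  obtain d where d: "d > 0" "\<And>w. \<lbrakk>w \<in> X; dist w (p x) < d\<rbrakk> \<Longrightarrow> dist (\<pi> w) (\<pi> (p x)) < r"
    using continuous_on_pi x(2) r(1) unfolding continuous_on_iff by metis
  have "min d e > 0" using d e by simp
  then obtain g where g: "g \<in> carrier T" "\<And>b. b \<in> B \<Longrightarrow> dist (act g b) (p b) < min d e"
    using ellis_approx[OF p B(1)] by metis
  show thesis
  proof (rule that[OF g(1)])
    show "dist (\<phi> g b) (p b) < e" if "b \<in> B" for b
      using g(2)[OF that] that B by (simp add: act_eq subset_iff)
    have "dist (\<pi> (\<phi> g x)) (\<pi> (p x)) < r"
      using g(2)[OF B(3)] x phi_in_X[OF g(1)] by (intro d(2)) (auto simp: act_eq)
    then show "\<pi> (\<phi> g x) \<in> U" using r(2) by (auto simp: dist_commute)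
  qed
qed

lemma fiber_phi_subset:
  assumes "g \<in> carrier T" "x \<in> X"
  shows "fiber X \<pi> (\<pi> (\<phi> g x)) \<subseteq> \<phi> g ` fiber X \<pi> (\<pi> x)"
proof
  fix z assume z: "z \<in> fiber X \<pi> (\<pi> (\<phi> g x))"
  let ?h = "inv\<^bsub>T\<^esub> g"
  have h: "?h \<in> carrier T" using assms by simp
  have zX: "z \<in> X" and pz: "\<pi> z = \<pi> (\<phi> g x)" using z by (auto simp: fiber_def)
  have "\<pi> (\<phi> ?h z) = \<pi> (\<phi> ?h (\<phi> g x))"
    using pi_phi[OF h] zX pz assms phi_in_X by simp
  then have "\<phi> ?h z \<in> fiber X \<pi> (\<pi> x)"
    using phi_in_X[OF h zX] phi_inv assms by (simp add: fiber_def)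
  moreover have "\<phi> g (\<phi> ?h z) = z"
    using phi_inv[OF h zX] assms by simp
  ultimately show "z \<in> \<phi> g ` fiber X \<pi> (\<pi> x)" by (metis image_eqI)
qed

section \<open>Distal points\<close>

lemma distal_point_iff:
  "distal_point T X \<phi> \<pi> x \<longleftrightarrow>
     x \<in> X \<and> (\<forall>x'\<in>X. \<forall>p\<in>ellis. \<pi> x' = \<pi> x \<longrightarrow> p x = p x' \<longrightarrow> x' = x)"
  unfolding distal_point_def using proximal_iff[of x] by (auto simp: fiber_def)

text \<open>If \<open>p\<close> collapses two points moved by \<open>g\<close>, then
  \<open>p \<circ> act g\<close> collapses the original points. With minimality, one distal point
  yields a dense set of them.\<close>

lemma distal_point_phi:
  assumes x: "distal_point T X \<phi> \<pi> x" and g: "g \<in> carrier T"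
  shows "distal_point T X \<phi> \<pi> (\<phi> g x)"
  unfolding distal_point_iff
proof (intro conjI ballI impI)
  have xX: "x \<in> X" using x by (simp add: distal_point_def)
  then show "\<phi> g x \<in> X" using g by (rule phi_in_X[rotated])
  fix x' p assume x': "x' \<in> X" and p: "p \<in> ellis" and eq: "\<pi> x' = \<pi> (\<phi> g x)" "p (\<phi> g x) = p x'"
  obtain z where z: "z \<in> X" "\<pi> z = \<pi> x" "x' = \<phi> g z"
    using fiber_phi_subset[OF g xX] x' eq by (auto simp: fiber_def)
  have "p \<circ> act g \<in> ellis" using ellis_comp p act_in_ellis g by blast
  moreover have "(p \<circ> act g) x = (p \<circ> act g) z" using eq z xX by (simp add: act_eq)
  ultimately have "z = x" using x z unfolding distal_point_iff by blast
  then show "x' = \<phi> g x" using z by simp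
qed

text \<open>A minimal idempotent \<open>u\<close> fixing \<open>B\<close> pointwise keeps
  \<open>x\<close> in its fiber and sends \<open>x\<close> and \<open>u x\<close> to the same point,
  so distality forces \<open>u x = x\<close>. Points fixed by one minimal idempotent are jointly
  minimal.\<close>

lemma jointly_minimal_insert_distal:
  assumes B: "jointly_minimal B" "B \<noteq> {}" "B \<subseteq> fiber X \<pi> (\<pi> x)"
    and x: "distal_point T X \<phi> \<pi> x"
  shows "jointly_minimal (insert x B)"
proof -
  obtain u where u: "u \<in> ellis" "u \<circ> u = u" "\<And>b. b \<in> B \<Longrightarrow> u b = b"
    "\<And>r. r \<in> ellis \<Longrightarrow> \<exists>q\<in>ellis. q \<circ> r \<circ> u = u"
    using minimal_idempotent[OF B(1)] by metis
  have xX: "x \<in> X" using x by (simp add: distal_point_def)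
  \<comment> \<open>A fixed point of \<open>u\<close> in the fiber of \<open>x\<close> shows that
    \<open>u\<close> maps this fiber into itself.\<close>
  obtain b where b: "b \<in> B" using B by blast
  then have "b \<in> X" "\<pi> b = \<pi> x" using B by (auto simp: fiber_def)
  then have "\<pi> (u x) = \<pi> x" using pi_ellis[of x b u] xX u b by simp
  moreover have "u x = u (u x)" using u(2) by (metis comp_apply)
  ultimately have ux: "u x = x"
    using x u(1) ellis_in_X[OF u(1) xX] unfolding distal_point_iff by blast
  show ?thesis
    unfolding jointly_minimal_def
  proof
    fix r assume "r \<in> ellis"
    then obtain q where q: "q \<in> ellis" "q \<circ> r \<circ> u = u" using u(4) by blast
    \<comment> \<open>On fixed points of \<open>u\<close>, the identity
      \<open>q \<circ> r \<circ> u = u\<close> says that \<open>q\<close> undoes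
      \<open>r\<close>.\<close>
    have "q (r a) = a" if "u a = a" for a
      using fun_cong[OF q(2), of a] that by simp
    then show "\<exists>q\<in>ellis. \<forall>a\<in>insert x B. q (r a) = a"
      using q(1) ux u(3) by blast
  qed
qed

section \<open>From almost proximal and point distal to a finite fiber\<close>

lemma almost_finite_to_one_if_point_distal:
  assumes ap: "almost_proximal T X \<phi> Y \<pi>" and pd: "point_distal T X \<phi> \<pi>"
  shows "almost_finite_to_one X Y \<pi>"
proof -
  obtain x0 where x0: "x0 \<in> X" "distal_point T X \<phi> \<pi> x0"
    using pd by (auto simp: point_distal_def)
  let ?F = "fiber X \<pi> (\<pi> x0)"
  have "\<pi> x0 \<in> Y" using x0 pi_image by blast
  then obtain N where N: "\<And>A. \<lbrakk>A \<subseteq> ?F; almost_periodic_set T X \<phi> A\<rbrakk> \<Longrightarrow> finite A \<and> card A \<le> N"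
    using ap unfolding almost_proximal_def by meson
  have FX: "?F \<subseteq> X" by (auto simp: fiber_def)
  define P where "P B \<longleftrightarrow> finite B \<and> B \<subseteq> ?F \<and> jointly_minimal B" for B
  have "card B \<le> N" if "P B" for B
  proof -
    have "almost_periodic_set T X \<phi> B"
      using that FX jointly_minimal_mono[of B] unfolding almost_periodic_set_iff P_def by blast
    then show ?thesis using N that unfolding P_def by blast
  qed
  moreover have Px0: "P {x0}"
    using x0 jointly_minimal_singleton by (auto simp: P_def fiber_def)
  ultimately obtain B0 where B0: "P B0" "\<And>B. P B \<Longrightarrow> card B \<le> card B0"
    using ex_has_greatest_nat[of P "{x0}" card "Suc N"] by (metis less_Suc_eq_le)
  define n where "n = card B0"
  have n: "n > 0" using B0(2)[OF Px0] by (simp add: n_def)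
  \<comment> \<open>Maximality in the fiber of \<open>x0\<close> bounds every fiber: an element of
    \<open>ellis\<close> sending a point of \<open>B\<close> to \<open>x0\<close> is injective on
    \<open>B\<close> and carries it into that fiber.\<close>
  have card_le: "card B \<le> n" if B: "finite B" "B \<subseteq> fiber X \<pi> y" "jointly_minimal B" for B y
  proof (cases "B = {}")
    case False
    then obtain b where b: "b \<in> B" by blast
    then have bX: "b \<in> X" using B by (auto simp: fiber_def)
    obtain p where p: "p \<in> ellis" "p b = x0" using ellis_transitive[OF bX x0(1)] .
    have "P (p ` B)"
      unfolding P_def
    proof (intro conjI subsetI)
      fix z assume "z \<in> p ` B"
      then obtain b' where b': "b' \<in> B" "z = p b'" by blast
      then have "b' \<in> X" "\<pi> b' = \<pi> b" using B b by (auto simp: fiber_def)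
      then have "z \<in> X" "\<pi> z = \<pi> (p b)" using b' bX p pi_ellis[of b' b p] ellis_in_X by auto
      then show "z \<in> ?F" using p by (simp add: fiber_def)
    qed (use B jointly_minimal_image p in auto)
    then show ?thesis
      using B0(2)[of "p ` B"] card_image[OF jointly_minimal_image(2)[OF B(3) p(1)]] by (simp add: n_def)
  qed simp
  have B0': "finite B0" "B0 \<subseteq> ?F" "jointly_minimal B0" using B0 by (auto simp: P_def)
  obtain f where f: "bij_betw f {..<n} B0"
    using ex_bij_betw_nat_finite[OF B0'(1)] by (auto simp: atLeast0LessThan n_def)
  \<comment> \<open>The enumeration is made total by repeating its entry 0 from \<open>n\<close> on,
    so that all entries lie in the fiber.\<close>
  define a where "a i = f (if i < n then i else 0)" for i
  have fB: "f ` {..<n} = B0" using f by (simp add: bij_betw_def)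
  have aB: "a i \<in> B0" for i
    using fB n by (auto simp: a_def)
  have a_img: "a ` {..<n} = B0" using fB by (auto simp: a_def)
  have aX: "a i \<in> X" "\<pi> (a i) = \<pi> x0" for i using aB[of i] B0' by (auto simp: fiber_def)
  \<comment> \<open>The compact set of translated enumerations. All entries of a tuple in
    \<open>M\<close> lie in one fiber, so its entry 0 gives the map to \<open>Y\<close>.\<close>
  define M where "M = (\<lambda>p. p \<circ> a) ` ellis"
  have M: "w i \<in> X" "\<pi> (w i) = \<pi> (w 0)" "jointly_minimal (w ` {..<n})" "card (w ` {..<n}) = n"
    if "w \<in> M" for w i
  proof -
    obtain p where p: "p \<in> ellis" "w = p \<circ> a" using \<open>w \<in> M\<close> by (auto simp: M_def)
    have img: "w ` {..<n} = p ` B0" unfolding p(2) image_comp[symmetric] a_img ..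
    show "w i \<in> X" using p aX ellis_in_X by simp
    show "\<pi> (w i) = \<pi> (w 0)" using p aX pi_ellis[of "a i" "a 0" p] by simp
    show "jointly_minimal (w ` {..<n})" "card (w ` {..<n}) = n"
      unfolding img using jointly_minimal_image[OF B0'(3) p(1)] by (simp_all add: card_image n_def)
  qed
  have "compact M"
    unfolding M_def by (intro compact_continuous_image continuous_on_comp_right_fun compact_ellis)
  moreover have "continuous_on M (\<lambda>w. \<pi> (w 0))"
  proof (rule continuous_on_compose2[OF continuous_on_pi])
    show "continuous_on M (\<lambda>w. w 0)"
      by (rule continuous_on_subset[OF continuous_on_product_coordinates]) simp
  qed (use M in auto)
  moreover have "(\<lambda>w. \<pi> (w 0)) ` M = Y"
  proof
    show "(\<lambda>w. \<pi> (w 0)) ` M \<subseteq> Y" using M(1) pi_image by auto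
    show "Y \<subseteq> (\<lambda>w. \<pi> (w 0)) ` M"
    proof
      fix y assume "y \<in> Y"
      then obtain x where x: "x \<in> X" "\<pi> x = y" using pi_image by blast
      obtain p where p: "p \<in> ellis" "p (a 0) = x" using ellis_transitive[OF aX(1)[of 0] x(1)] .
      have "p \<circ> a \<in> M" "y = \<pi> ((p \<circ> a) 0)" using p x by (auto simp: M_def)
      then show "y \<in> (\<lambda>w. \<pi> (w 0)) ` M" by blast
    qed
  qed
  moreover have "Y \<noteq> {}" using x0 pi_image by blast
  ultimately obtain y where y: "y \<in> Y" and opn: "open_along_fiber M (\<lambda>w. \<pi> (w 0)) y"
    by (rule exists_open_fiber)
  obtain z where z: "z \<in> M" "\<pi> (z 0) = y"
    using y \<open>(\<lambda>w. \<pi> (w 0)) ` M = Y\<close> by blast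
  have "fiber X \<pi> y \<subseteq> z ` {..<n}"
  proof (rule ccontr)
    assume "\<not> fiber X \<pi> y \<subseteq> z ` {..<n}"
    then obtain x where x: "x \<in> X" "\<pi> x = y" "x \<notin> z ` {..<n}" by (auto simp: fiber_def)
    obtain d where d: "d > 0" "\<And>x'. \<lbrakk>x' \<in> z ` {..<n}; x' \<noteq> x\<rbrakk> \<Longrightarrow> d \<le> dist x x'"
      using finite_set_avoid[of "z ` {..<n}" x] by auto
    \<comment> \<open>Only the first \<open>n\<close> coordinates are controlled; they already
      exhaust the range of \<open>z\<close>.\<close>
    have "open {w. \<forall>i\<in>{..<n}. w i \<in> ball (z i) (d / 2)}"
      using product_topology_basis'[of "{..<n}" "\<lambda>i. ball (z i) (d / 2)" "\<lambda>i. i"] by simp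
    moreover have "z \<in> {w. \<forall>i\<in>{..<n}. w i \<in> ball (z i) (d / 2)}" using d by simp
    ultimately obtain e where e: "e > 0" "ball z e \<subseteq> {w. \<forall>i\<in>{..<n}. w i \<in> ball (z i) (d / 2)}"
      using openE by blast
    obtain U where U: "open U" "y \<in> U" "U \<inter> Y \<subseteq> (\<lambda>w. \<pi> (w 0)) ` (M \<inter> ball z e)"
      using opn z e(1) unfolding open_along_fiber_def \<open>(\<lambda>w. \<pi> (w 0)) ` M = Y\<close> by blast
    \<comment> \<open>A translate of the distal point \<open>x0\<close> comes close to
      \<open>x\<close>, over a point so close to \<open>y\<close> that openness gives a tuple
      \<open>w\<close> near \<open>z\<close> over the same point.\<close>
    obtain p where p: "p \<in> ellis" "p x0 = x" using ellis_transitive[OF x0(1) x(1)] .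
    obtain g where g: "g \<in> carrier T" "\<pi> (\<phi> g x0) \<in> U" "dist (\<phi> g x0) x < d / 2"
      using extension_approx[OF p(1), of "{x0}" x0 U "d / 2"] U x x0 p d by auto
    let ?x = "\<phi> g x0"
    have xX: "?x \<in> X" using phi_in_X g x0 by blast
    then have "\<pi> ?x \<in> U \<inter> Y" using g pi_image by blast
    then obtain w where w: "w \<in> M" "w \<in> ball z e" "\<pi> ?x = \<pi> (w 0)" using U(3) by blast
    let ?B = "w ` {..<n}"
    have B: "?B \<subseteq> fiber X \<pi> (\<pi> ?x)" using M[OF w(1)] w(3) by (auto simp: fiber_def)
    \<comment> \<open>The entries of \<open>w\<close> already form a jointly minimal set of the
      maximal size \<open>n\<close>, so the distal point must be one of them; this brings some
      \<open>z i\<close> too close to \<open>x\<close>.\<close>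
    have "jointly_minimal (insert ?x ?B)"
      using M(3)[OF w(1)] B n distal_point_phi[OF x0(2) g(1)]
      by (intro jointly_minimal_insert_distal) auto
    then have "card (insert ?x ?B) \<le> n"
      using B xX by (intro card_le[of _ "\<pi> ?x"]) (auto simp: fiber_def)
    then have "?x \<in> ?B" using M(4)[OF w(1)] by (metis card_insert_disjoint finite_imageI finite_lessThan not_less_eq_eq order_refl)
    then obtain i where i: "i < n" "?x = w i" by auto
    then have "dist (z i) ?x < d / 2" using e(2) w(2) by auto
    then have "dist x (z i) < d" using g(3) dist_triangle[of x "z i" ?x] by (simp add: dist_commute)
    moreover have "z i \<in> z ` {..<n}" "z i \<noteq> x" using i x by auto
    ultimately show False using d(2)[of "z i"] by simp
  qed
  then have "finite (fiber X \<pi> y)" by (rule finite_subset) simp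
  then show ?thesis using y by (auto simp: almost_finite_to_one_def)
qed

section \<open>From a finite fiber to almost proximal and point distal\<close>

text \<open>Some element of \<open>ellis\<close> carries a given jointly minimal subset of a fiber
  injectively into the finite fiber, whose size is therefore a bound for all fibers at once.\<close>

lemma almost_proximal_if_almost_finite_to_one:
  assumes "almost_finite_to_one X Y \<pi>"
  shows "almost_proximal T X \<phi> Y \<pi>"
proof -
  obtain y0 where y0: "y0 \<in> Y" "finite (fiber X \<pi> y0)"
    using assms by (auto simp: almost_finite_to_one_def)
  let ?F = "fiber X \<pi> y0"
  obtain x0 where x0: "x0 \<in> X" "\<pi> x0 = y0" using y0 pi_image by blast
  have le: "card B \<le> card ?F" if B: "finite B" "B \<subseteq> fiber X \<pi> y" "jointly_minimal B" for B y
  proof (cases "B = {}")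
    case False
    then obtain b where b: "b \<in> B" by blast
    then have bX: "b \<in> X" using B by (auto simp: fiber_def)
    obtain p where p: "p \<in> ellis" "p b = x0" using ellis_transitive[OF bX x0(1)] .
    have "p ` B \<subseteq> ?F"
    proof
      fix z assume "z \<in> p ` B"
      then obtain b' where b': "b' \<in> B" "z = p b'" by blast
      then have "b' \<in> X" "\<pi> b' = \<pi> b" using B b by (auto simp: fiber_def)
      then have "z \<in> X" "\<pi> z = \<pi> (p b)" using b' bX p pi_ellis[of b' b p] ellis_in_X by auto
      then show "z \<in> ?F" using p x0 by (simp add: fiber_def)
    qed
    then show ?thesis
      using card_mono[OF y0(2)] card_image[OF jointly_minimal_image(2)[OF B(3) p(1)]] by metis
  qed simp
  show ?thesis
    unfolding almost_proximal_def
  proof (intro ballI exI allI impI)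
    fix y A assume A: "A \<subseteq> fiber X \<pi> y \<and> almost_periodic_set T X \<phi> A"
    then have "card B \<le> card ?F" if "finite B" "B \<subseteq> A" for B
      using that le[of B y] unfolding almost_periodic_set_iff by blast
    \<comment> \<open>An infinite \<open>A\<close> would contain a finite subset with one point more
      than \<open>?F\<close>.\<close>
    then show "finite A \<and> card A \<le> card ?F"
      using infinite_arbitrarily_large[of A "Suc (card ?F)"] by (metis Suc_n_not_le_n order_refl)
  qed
qed

text \<open>Openness puts a point of each nearby fiber within \<open>e\<close> of every point of
  \<open>B\<close>, and the separation makes these points distinct.\<close>

lemma fiber_injection:
  assumes opn: "open_along_fiber X \<pi> y"
    and B: "finite B" "B \<subseteq> fiber X \<pi> y" and e: "e > 0"
    and sep: "\<forall>x\<in>B. \<forall>x'\<in>B. dist x x' < 2 * e \<longrightarrow> x = x'"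
  obtains U where "open U" "y \<in> U"
    "\<And>y'. y' \<in> U \<inter> Y \<Longrightarrow> \<exists>c. inj_on c B \<and> c ` B \<subseteq> fiber X \<pi> y' \<and> (\<forall>x\<in>B. dist x (c x) < e)"
proof -
  have "\<exists>U. open U \<and> y \<in> U \<and> U \<inter> Y \<subseteq> \<pi> ` (X \<inter> ball x e)" if "x \<in> B" for x
    using opn e that B unfolding open_along_fiber_def pi_image by (auto simp: fiber_def)
  then obtain U where U: "\<And>x. x \<in> B \<Longrightarrow> open (U x) \<and> y \<in> U x \<and> U x \<inter> Y \<subseteq> \<pi> ` (X \<inter> ball x e)"
    by metis
  show thesis
  proof (rule that)
    show "open (\<Inter>x\<in>B. U x)" using B U by (intro open_INT) auto
    show "y \<in> (\<Inter>x\<in>B. U x)" using U by auto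
    fix y' assume y': "y' \<in> (\<Inter>x\<in>B. U x) \<inter> Y"
    have "\<exists>z. z \<in> X \<and> \<pi> z = y' \<and> dist x z < e" if "x \<in> B" for x
    proof -
      have "y' \<in> \<pi> ` (X \<inter> ball x e)" using U[OF that] y' that by blast
      then show ?thesis by auto
    qed
    then obtain c where c: "\<And>x. x \<in> B \<Longrightarrow> c x \<in> X \<and> \<pi> (c x) = y' \<and> dist x (c x) < e"
      by metis
    have "inj_on c B"
    proof (rule inj_onI)
      fix x x' assume xx: "x \<in> B" "x' \<in> B" "c x = c x'"
      then have "dist x x' < 2 * e"
        using c[of x] c[of x'] dist_triangle2[of x x' "c x"] by simp
      then show "x = x'" using sep xx by blast
    qed
    then show "\<exists>c. inj_on c B \<and> c ` B \<subseteq> fiber X \<pi> y' \<and> (\<forall>x\<in>B. dist x (c x) < e)"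
      using c by (intro exI[of _ c]) (auto simp: fiber_def)
  qed
qed

text \<open>Over a point \<open>y\<close> where \<open>\<pi>\<close> is open, nearby fibers are at
  least as large as any finite part of the fiber of \<open>y\<close>. Comparison with translates of
  the given finite fiber makes the fiber of \<open>y\<close> finite; comparison with its own
  translates leaves no room for a proximal pair.\<close>

lemma point_distal_if_almost_finite_to_one:
  assumes "almost_finite_to_one X Y \<pi>"
  shows "point_distal T X \<phi> \<pi>"
proof -
  obtain y0 where y0: "y0 \<in> Y" "finite (fiber X \<pi> y0)"
    using assms by (auto simp: almost_finite_to_one_def)
  let ?G = "fiber X \<pi> y0"
  obtain x0 where x0: "x0 \<in> X" "\<pi> x0 = y0" using y0 pi_image by blast
  have "Y \<noteq> {}" using y0 by blast
  with compact_X continuous_on_pi pi_image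
  obtain y where y: "y \<in> Y" and opn: "open_along_fiber X \<pi> y"
    by (rule exists_open_fiber)
  obtain x where x: "x \<in> X" "\<pi> x = y" using y pi_image by blast
  let ?F = "fiber X \<pi> y"
  have "card B \<le> card ?G" if B: "finite B" "B \<subseteq> ?F" for B
  proof -
    obtain e where e: "e > 0" "\<forall>x\<in>B. \<forall>x'\<in>B. dist x x' < 2 * e \<longrightarrow> x = x'"
      by (rule finite_separated[OF B(1)])
    obtain U where U: "open U" "y \<in> U"
      "\<And>y'. y' \<in> U \<inter> Y \<Longrightarrow> \<exists>c. inj_on c B \<and> c ` B \<subseteq> fiber X \<pi> y' \<and> (\<forall>x\<in>B. dist x (c x) < e)"
      by (rule fiber_injection[OF opn B e]) blast
    \<comment> \<open>Moving \<open>x0\<close> close to \<open>x\<close> produces a translate of the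
      finite fiber over a point of \<open>U\<close>, and \<open>B\<close> injects into it.\<close>
    obtain p where p: "p \<in> ellis" "p x0 = x" using ellis_transitive[OF x0(1) x(1)] .
    have "finite {x0}" "{x0} \<subseteq> X" "x0 \<in> {x0}" "\<pi> (p x0) \<in> U" "(1::real) > 0"
      using x0 p x U by auto
    then obtain g where g: "g \<in> carrier T" "\<pi> (\<phi> g x0) \<in> U"
      using extension_approx[OF p(1), of "{x0}" x0 U 1] U(1) by metis
    have "\<pi> (\<phi> g x0) \<in> U \<inter> Y" using g pi_image phi_in_X x0 by blast
    then obtain c where c: "inj_on c B" "c ` B \<subseteq> fiber X \<pi> (\<pi> (\<phi> g x0))" using U(3) by blast
    have "c ` B \<subseteq> \<phi> g ` ?G"
      using subset_trans[OF c(2) fiber_phi_subset[OF g(1) x0(1)]] by (simp add: x0(2))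
    then have "card B \<le> card (\<phi> g ` ?G)" using c y0 by (metis card_image card_mono finite_imageI)
    also have "\<dots> \<le> card ?G" using y0(2) by (rule card_image_le)
    finally show ?thesis .
  qed
  then have fin: "finite ?F"
    using infinite_arbitrarily_large[of ?F "Suc (card ?G)"] by (metis Suc_n_not_le_n)
  have "distal_point T X \<phi> \<pi> x"
    unfolding distal_point_iff
  proof (intro conjI ballI impI)
    show "x \<in> X" by (rule x)
    fix x' p assume x': "x' \<in> X" "\<pi> x' = \<pi> x" and p: "p \<in> ellis" "p x = p x'"
    \<comment> \<open>Returning the common image to \<open>x\<close> gives one element of
      \<open>ellis\<close> sending both \<open>x\<close> and \<open>x'\<close> to \<open>x\<close>;
      some \<open>g\<close> then moves both points close to \<open>x\<close>.\<close>
    obtain q where q: "q \<in> ellis" "q (p x) = x"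
      using ellis_transitive[OF ellis_in_X[OF p(1) x(1)] x(1)] .
    have r: "q \<circ> p \<in> ellis" "(q \<circ> p) x = x" "(q \<circ> p) x' = x"
      using ellis_comp[OF q(1) p(1)] q p by auto
    obtain e where e: "e > 0" "\<forall>x\<in>?F. \<forall>x'\<in>?F. dist x x' < 2 * e \<longrightarrow> x = x'"
      by (rule finite_separated[OF fin])
    obtain U where U: "open U" "y \<in> U"
      "\<And>y'. y' \<in> U \<inter> Y \<Longrightarrow> \<exists>c. inj_on c ?F \<and> c ` ?F \<subseteq> fiber X \<pi> y' \<and> (\<forall>x\<in>?F. dist x (c x) < e)"
      by (rule fiber_injection[OF opn fin subset_refl e]) blast
    have "finite {x, x'}" "{x, x'} \<subseteq> X" "x \<in> {x, x'}" "\<pi> ((q \<circ> p) x) \<in> U"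
      using r x x' U by auto
    then obtain g where g: "g \<in> carrier T" "\<pi> (\<phi> g x) \<in> U" "\<And>b. b \<in> {x, x'} \<Longrightarrow> dist (\<phi> g b) ((q \<circ> p) b) < e"
      using extension_approx[OF r(1), of "{x, x'}" x U e] U(1) e(1) by metis
    have "\<pi> (\<phi> g x) \<in> U \<inter> Y" using g pi_image phi_in_X x by blast
    from U(3)[OF this]
    obtain c where c: "inj_on c ?F" "c ` ?F \<subseteq> fiber X \<pi> (\<pi> (\<phi> g x))"
      and c_near: "\<forall>a\<in>?F. dist a (c a) < e"
      by auto
    have "c ` ?F \<subseteq> \<phi> g ` ?F"
      using subset_trans[OF c(2) fiber_phi_subset[OF g(1) x(1)]] by (simp add: x(2))
    \<comment> \<open>Injectivity of \<open>c\<close> leaves no other points in the translated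
      fiber: each of them is \<open>c a\<close> for some \<open>a\<close>, and within
      \<open>e\<close> of that \<open>a\<close>.\<close>
    moreover have "card (\<phi> g ` ?F) \<le> card (c ` ?F)"
      using card_image_le[OF fin] card_image[OF c(1)] by simp
    ultimately have cF: "c ` ?F = \<phi> g ` ?F" using fin by (intro card_seteq) auto
    \<comment> \<open>\<open>\<phi> g b\<close> is within \<open>e\<close> of \<open>x\<close> and
      of the \<open>a\<close> with \<open>\<phi> g b = c a\<close>, so separation gives
      \<open>a = x\<close>. Thus \<open>\<phi> g\<close> would identify \<open>x\<close> and
      \<open>x'\<close>.\<close>
    have near: "\<phi> g b = c x" if "b \<in> {x, x'}" for b
    proof -
      have "b \<in> ?F" using that x x' by (auto simp: fiber_def)
      then obtain a where a: "a \<in> ?F" "\<phi> g b = c a" using cF by blast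
      have "dist (c a) x < e" using g(3)[OF that] a r that by auto
      then have "dist a x < 2 * e" using bspec[OF c_near a(1)] dist_triangle[of a x "c a"] by simp
      then have "a = x" using e(2) a(1) x by (simp add: fiber_def)
      then show ?thesis using a by simp
    qed
    then have "\<phi> g x = \<phi> g x'" by simp
    then show "x' = x" using phi_inv[OF g(1)] x(1) x'(1) by metis
  qed
  then show ?thesis using x by (auto simp: point_distal_def)
qed

end

theorem theorem3p16:
  fixes T :: "('g, 'm) monoid_scheme"
    and X :: "'a::metric_space set" and \<phi> :: "'g \<Rightarrow> 'a \<Rightarrow> 'a"
    and Y :: "'b::metric_space set" and \<psi> :: "'g \<Rightarrow> 'b \<Rightarrow> 'b"
    and \<pi> :: "'a \<Rightarrow> 'b"
  assumes "group T" and "infinite (carrier T)" and "countable (carrier T)"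
    and "minimal_flow T X \<phi>" and "minimal_flow T Y \<psi>"
    and "flow_extension T X \<phi> Y \<psi> \<pi>"
  shows "almost_proximal T X \<phi> Y \<pi> \<and> point_distal T X \<phi> \<pi> \<longleftrightarrow> almost_finite_to_one X Y \<pi>"
proof -
  interpret minimal_extension T X \<phi> Y \<psi> \<pi>
    by (intro minimal_extension.intro minimal_system.intro minimal_extension_axioms.intro assms)
  show ?thesis
    using almost_finite_to_one_if_point_distal almost_proximal_if_almost_finite_to_one
      point_distal_if_almost_finite_to_one by blast
qed

end
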